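(* Let $G\in\mathcal{G}_n^{sc}$ with Hermitian adjacency matrix $A$ and walk-matrix $W=[e,Ae,\ldots,A^{n-1}e]$ such that $\det W\neq0$. Then for every $U\in\mathscr{U}_G$, $\ell(U)$ and $\overline{\ell(U)}$ are associates in $\mathbb{Z}[i]$; that is, $\ell(U)=a$ or $\ell(U)=a(1+i)$ for some positive integer $a$.
   Context: A mixed graph is obtained from a simple undirected graph by orienting a subset of edges; $\mathcal{G}_n$ is the set of mixed graphs on $[n]$. The Hermitian adjacency matrix $A(G)=(a_{u,v})$ has $a_{u,v}=1$ for an undirected edge $uv$, $i$ for a directed edge $u\to v$, $-i$ for a directed edge $v\to u$, $0$ otherwise. $G$ is self-converse if isomorphic to the mixed graph obtained by reversing every directed edge; $\mathcal{G}_n^{sc}$ is the set of self-converse mixed graphs on $[n]$. $e$ is the all-one vector. Two Gaussian integers are associates if one is a unit ($\pm1,\pm i$) times the other. Let $\Gamma=\{z\in\mathbb{Z}[i]:\mathrm{Re}(z)>0,\mathrm{Im}(z)\ge0\}$. For a Gaussian rational unitary matrix $U$, the level $\ell(U)$ is the unique $\ell\in\Gamma$ with $\ell U$ Gaussian integral and $N(\ell)=|\ell|^2$ minimal. $\mathscr{U}_G$ is the set of Gaussian rational unitary matrices $U$ with $Ue=e$ and $U^*A(G)U=A(H)$ for some $H\in\mathcal{G}_n^{sc}$. *)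

theory Defs
  imports Complex_Main "Jordan_Normal_Form.Schur_Decomposition"
begin

text \<open>The vertex set \<open>[n]\<close> is \<open>{..<n}\<close>, matching the index ranges of matrices and vectors.\<close>

record mixed_graph =
  edges :: "nat set set"
  arcs :: "(nat \<times> nat) set"

definition mixed_graphs :: "nat \<Rightarrow> mixed_graph set" where
  "mixed_graphs n = {G.
     edges G \<subseteq> {{u, v} | u v. u < n \<and> v < n \<and> u \<noteq> v} \<and>
     arcs G \<subseteq> {(u, v). u < n \<and> v < n \<and> u \<noteq> v} \<and>
     (\<forall>u v. (u, v) \<in> arcs G \<longrightarrow> (v, u) \<notin> arcs G \<and> {u, v} \<notin> edges G)}"

definition converse_graph :: "mixed_graph \<Rightarrow> mixed_graph" where
  "converse_graph G = \<lparr>edges = edges G, arcs = (arcs G)\<inverse>\<rparr>"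

definition mixed_graph_iso :: "nat \<Rightarrow> mixed_graph \<Rightarrow> mixed_graph \<Rightarrow> bool" where
  "mixed_graph_iso n G H \<longleftrightarrow> (\<exists>f. bij_betw f {..<n} {..<n} \<and>
     (\<forall>u<n. \<forall>v<n. ({u, v} \<in> edges G \<longleftrightarrow> {f u, f v} \<in> edges H) \<and>
                  ((u, v) \<in> arcs G \<longleftrightarrow> (f u, f v) \<in> arcs H)))"

definition self_converse_graphs :: "nat \<Rightarrow> mixed_graph set" where
  "self_converse_graphs n = {G \<in> mixed_graphs n. mixed_graph_iso n G (converse_graph G)}"

definition herm_adj :: "nat \<Rightarrow> mixed_graph \<Rightarrow> complex mat" where
  "herm_adj n G = mat n n (\<lambda>(u, v).
     if {u, v} \<in> edges G then 1
     else if (u, v) \<in> arcs G then \<i>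
     else if (v, u) \<in> arcs G then - \<i>
     else 0)"

definition all_one_vec :: "nat \<Rightarrow> complex vec" where
  "all_one_vec n = vec n (\<lambda>_. 1)"

definition walk_matrix :: "nat \<Rightarrow> complex mat \<Rightarrow> complex mat" where
  "walk_matrix n A = mat_of_cols n (map (\<lambda>k. (A ^\<^sub>m k) *\<^sub>v all_one_vec n) [0..<n])"

definition gauss_ints :: "complex set" where
  "gauss_ints = {z. Re z \<in> \<int> \<and> Im z \<in> \<int>}"

definition gauss_rats :: "complex set" where
  "gauss_rats = {z. Re z \<in> \<rat> \<and> Im z \<in> \<rat>}"

definition gauss_associates :: "complex \<Rightarrow> complex \<Rightarrow> bool" where
  "gauss_associates z w \<longleftrightarrow> z \<in> gauss_ints \<and> w \<in> gauss_ints \<and>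
     (\<exists>u\<in>{1, -1, \<i>, -\<i>}. z = u * w)"

definition gauss_Gamma :: "complex set" where
  "gauss_Gamma = {z \<in> gauss_ints. Re z > 0 \<and> Im z \<ge> 0}"

definition unitary_mat :: "nat \<Rightarrow> complex mat \<Rightarrow> bool" where
  "unitary_mat n U \<longleftrightarrow> U \<in> carrier_mat n n \<and>
     mat_adjoint U * U = 1\<^sub>m n \<and> U * mat_adjoint U = 1\<^sub>m n"

definition gauss_rat_unitary :: "nat \<Rightarrow> complex mat \<Rightarrow> bool" where
  "gauss_rat_unitary n U \<longleftrightarrow> unitary_mat n U \<and> elements_mat U \<subseteq> gauss_rats"

text \<open>For a Gaussian rational matrix the description below determines a unique element:
  the Gaussian integers \<open>l\<close> making \<open>l U\<close> integral form a nonzero principal ideal, and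
  \<open>gauss_Gamma\<close> contains exactly one element of each nonzero class of associates.\<close>

definition level :: "complex mat \<Rightarrow> complex" where
  "level U = (THE l. l \<in> gauss_Gamma \<and> elements_mat (l \<cdot>\<^sub>m U) \<subseteq> gauss_ints \<and>
     (\<forall>m\<in>gauss_Gamma. elements_mat (m \<cdot>\<^sub>m U) \<subseteq> gauss_ints \<longrightarrow> (cmod l)\<^sup>2 \<le> (cmod m)\<^sup>2))"

definition unitary_set :: "nat \<Rightarrow> mixed_graph \<Rightarrow> complex mat set" where
  "unitary_set n G = {U. gauss_rat_unitary n U \<and> U *\<^sub>v all_one_vec n = all_one_vec n \<and>
     (\<exists>H\<in>self_converse_graphs n. mat_adjoint U * herm_adj n G * U = herm_adj n H)}"

end

theory Submission
  imports Defs
begin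

text \<open>Reversing arcs conjugates the Hermitian adjacency matrix, so a self-converse graph has
  \<open>A (f u, f v) = cnj (A (u, v))\<close> for a permutation \<open>f\<close>, and the walk matrix inherits
  \<open>W (f u, k) = cnj (W (u, k))\<close>. Since \<open>U W\<^sub>H = W\<^sub>G\<close> determines \<open>U\<close>, applying this symmetry on both
  sides shows that \<open>U\<close> coincides with its own conjugate up to permutations of rows and columns.
  Hence the ideal of Gaussian integers clearing the denominators of \<open>U\<close> is closed under
  conjugation, and its generator, the level, is an associate of its conjugate.\<close>

subsection \<open>Gaussian integers\<close>

lemma gauss_ints_diff: "z \<in> gauss_ints \<Longrightarrow> w \<in> gauss_ints \<Longrightarrow> z - w \<in> gauss_ints"
  by (simp add: gauss_ints_def)

lemma gauss_ints_mult: "z \<in> gauss_ints \<Longrightarrow> w \<in> gauss_ints \<Longrightarrow> z * w \<in> gauss_ints"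
  by (simp add: gauss_ints_def)

lemma gauss_ints_cnj: "cnj z \<in> gauss_ints \<longleftrightarrow> z \<in> gauss_ints"
  by (simp add: gauss_ints_def)

lemma gauss_ints_of_nat: "of_nat k \<in> gauss_ints"
  by (simp add: gauss_ints_def)

lemma gauss_ints_norm_nat:
  assumes "z \<in> gauss_ints"
  obtains k :: nat where "(cmod z)\<^sup>2 = real k"
proof -
  obtain x y :: int where "Re z = of_int x" "Im z = of_int y"
    using assms by (auto simp: gauss_ints_def elim!: Ints_cases)
  then have "(cmod z)\<^sup>2 = of_int (x\<^sup>2 + y\<^sup>2)"
    by (simp add: cmod_power2)
  then have "(cmod z)\<^sup>2 = real (nat (x\<^sup>2 + y\<^sup>2))"
    by simp
  then show ?thesis by (rule that)
qed

lemma gauss_ints_norm_1: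
  assumes "z \<in> gauss_ints" "cmod z = 1"
  shows "z \<in> {1, -1, \<i>, -\<i>}"
proof -
  obtain x y :: int where xy: "Re z = of_int x" "Im z = of_int y"
    using assms(1) by (auto simp: gauss_ints_def elim!: Ints_cases)
  have "(cmod z)\<^sup>2 = of_int (x\<^sup>2 + y\<^sup>2)"
    using xy by (simp add: cmod_power2)
  then have eq: "x\<^sup>2 + y\<^sup>2 = 1"
    using assms(2) by (simp flip: of_int_power of_int_add)
  then have "x\<^sup>2 \<le> 1" "y\<^sup>2 \<le> 1"
    using zero_le_power2[of x] zero_le_power2[of y] by linarith+
  then have "\<bar>x\<bar> \<le> 1" "\<bar>y\<bar> \<le> 1"
    by (simp_all add: abs_square_le_1)
  then have "x \<in> {-1, 0, 1}" "y \<in> {-1, 0, 1}"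
    by auto
  with eq xy show ?thesis
    by (auto simp: complex_eq_iff)
qed

text \<open>Rounding each coordinate leaves an error of at most 1/2, so the squared distance is at
  most 1/2. This is the division step that makes the Gaussian integers Euclidean.\<close>

lemma gauss_ints_approx:
  obtains q where "q \<in> gauss_ints" "cmod (z - q) < 1"
proof
  let ?q = "Complex (of_int (round (Re z))) (of_int (round (Im z)))"
  show "?q \<in> gauss_ints" by (simp add: gauss_ints_def)
  have "\<bar>Re (z - ?q)\<bar> \<le> 1/2" "\<bar>Im (z - ?q)\<bar> \<le> 1/2"
    using of_int_round_abs_le[of "Re z"] of_int_round_abs_le[of "Im z"] by (simp_all add: abs_minus_commute)
  then have "(Re (z - ?q))\<^sup>2 \<le> (1/2)\<^sup>2" "(Im (z - ?q))\<^sup>2 \<le> (1/2)\<^sup>2"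
    by (metis abs_le_square_iff abs_of_nonneg zero_le_divide_1_iff zero_le_numeral)+
  then have "(cmod (z - ?q))\<^sup>2 < 1\<^sup>2"
    unfolding cmod_power2 by (simp add: power2_eq_square)
  then show "cmod (z - ?q) < 1"
    by (rule power2_less_imp_less) simp
qed

section \<open>Units and the quarter plane \<open>gauss_Gamma\<close>\<close>

text \<open>The four half-open quarter planes of the case split cover the nonzero numbers and are
  the rotations of \<open>gauss_Gamma\<close> by the units; the witness rotates back.\<close>

lemma gauss_Gamma_associate:
  assumes "z \<in> gauss_ints" "z \<noteq> 0"
  obtains u where "u \<in> {1, -1, \<i>, -\<i>}" "u * z \<in> gauss_Gamma"
proof -
  consider "Re z > 0" "Im z \<ge> 0" | "Re z \<le> 0" "Im z > 0" | "Re z < 0" "Im z \<le> 0"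
    | "Re z \<ge> 0" "Im z < 0"
  proof -
    have "Re z \<noteq> 0 \<or> Im z \<noteq> 0"
      using assms(2) by (auto simp: complex_eq_iff)
    then have "Re z > 0 \<and> Im z \<ge> 0 \<or> Re z \<le> 0 \<and> Im z > 0 \<or> Re z < 0 \<and> Im z \<le> 0
        \<or> Re z \<ge> 0 \<and> Im z < 0"
      by linarith
    then show thesis using that by blast
  qed
  then show ?thesis
  proof cases
    case 1
    then show ?thesis using assms(1) by (intro that[of 1]) (auto simp: gauss_Gamma_def)
  next
    case 2
    then show ?thesis using assms(1)
      by (intro that[of "-\<i>"]) (auto simp: gauss_Gamma_def gauss_ints_def)
  next
    case 3
    then show ?thesis using assms(1)
      by (intro that[of "-1"]) (auto simp: gauss_Gamma_def gauss_ints_def)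
  next
    case 4
    then show ?thesis using assms(1)
      by (intro that[of "\<i>"]) (auto simp: gauss_Gamma_def gauss_ints_def)
  qed
qed

lemma gauss_Gamma_unit_multiple:
  assumes "z \<in> gauss_Gamma" "u * z \<in> gauss_Gamma" "u \<in> {1, -1, \<i>, -\<i>}"
  shows "u = 1"
  using assms by (auto simp: gauss_Gamma_def)

lemma gauss_Gamma_associate_cnj:
  assumes "l \<in> gauss_Gamma" "u \<in> {1, -1, \<i>, -\<i>}" "cnj l = u * l"
  shows "\<exists>a::nat. a > 0 \<and> (l = of_nat a \<or> l = of_nat a * (1 + \<i>))"
proof -
  have pos: "Re l > 0" "Im l \<ge> 0" and "Re l \<in> \<int>"
    using assms(1) by (auto simp: gauss_Gamma_def gauss_ints_def)
  then obtain x :: int where x: "Re l = of_int x" by (auto elim: Ints_cases)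
  define a where "a = nat x"
  have a: "a > 0" "Re l = of_nat a"
    using x pos by (simp_all add: a_def)
  \<comment> \<open>\<open>u = 1\<close> makes the imaginary part vanish and
    \<open>u = -\<i>\<close> makes the two parts equal. The units \<open>-1\<close> and
    \<open>\<i>\<close> would give \<open>Re l = 0\<close> and \<open>Re l = - Im l\<close>, which
    \<open>pos\<close> excludes.\<close>
  have "Im l = 0 \<or> Im l = Re l"
    using assms(2,3) pos by (auto simp: complex_eq_iff)
  then have "l = of_nat a \<or> l = of_nat a * (1 + \<i>)"
    using a by (auto simp: complex_eq_iff)
  with a show ?thesis by blast
qed

section \<open>Common denominators of Gaussian rationals\<close>

lemma gauss_rats_denominator:
  assumes "z \<in> gauss_rats"
  obtains d :: nat where "d > 0" "of_nat d * z \<in> gauss_ints"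
proof -
  have *: "\<exists>d::nat. d > 0 \<and> real d * r \<in> \<int>" if r: "r \<in> \<rat>" for r :: real
  proof -
    obtain a :: int and b :: nat where "b \<noteq> 0" "r = of_int a / real b"
      using r unfolding Rats_eq_int_div_nat by blast
    then show ?thesis by (intro exI[of _ b]) simp
  qed
  obtain d e :: nat where de: "d > 0" "real d * Re z \<in> \<int>" "e > 0" "real e * Im z \<in> \<int>"
    using assms *[of "Re z"] *[of "Im z"] by (auto simp: gauss_rats_def)
  have "real e * (real d * Re z) \<in> \<int>" "real d * (real e * Im z) \<in> \<int>"
    using de by (auto intro: Ints_mult)
  then show ?thesis
    using de by (intro that[of "d * e"]) (simp_all add: gauss_ints_def mult_ac)
qed

lemma gauss_rats_common_denominator:
  assumes "finite S" "S \<subseteq> gauss_rats"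
  shows "\<exists>d::nat. d > 0 \<and> (\<forall>z\<in>S. of_nat d * z \<in> gauss_ints)"
  using assms
proof (induction S rule: finite_induct)
  case empty
  then show ?case by auto
next
  case (insert w S)
  then obtain d :: nat where d: "d > 0" "\<And>z. z \<in> S \<Longrightarrow> of_nat d * z \<in> gauss_ints"
    by auto
  obtain e :: nat where e: "e > 0" "of_nat e * w \<in> gauss_ints"
    using gauss_rats_denominator[of w] insert.prems by auto
  have "of_nat (d * e) * z \<in> gauss_ints" if "z \<in> insert w S" for z
  proof (cases "z = w")
    case True
    then show ?thesis
      using gauss_ints_mult[OF gauss_ints_of_nat e(2), of d] by (simp add: mult.assoc)
  next
    case False
    then show ?thesis
      using gauss_ints_mult[OF gauss_ints_of_nat d(2), of z e] that by (simp add: mult_ac)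
  qed
  then show ?case using d e by (intro exI[of _ "d * e"]) auto
qed

subsection \<open>The level generates the ideal of denominators\<close>

lemma elements_smult_mat:
  "elements_mat (l \<cdot>\<^sub>m U) \<subseteq> S \<longleftrightarrow> (\<forall>z\<in>elements_mat U. l * z \<in> S)"
proof -
  have "elements_mat (l \<cdot>\<^sub>m U) = (\<lambda>z. l * z) ` elements_mat U"
    by (force simp: elements_mat_def image_iff)
  then show ?thesis by auto
qed

lemma finite_elements_mat: "finite (elements_mat U)"
  by (simp add: elements_mat_def)

text \<open>The Gaussian integers clearing the denominators of \<open>U\<close> form an ideal, here
  \<open>I\<close>, and Euclidean division shows that a nonzero element of least norm generates it.
  Choosing it in \<open>gauss_Gamma\<close> fixes the unit, so the description in
  \<open>level\<close> denotes it.\<close>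

lemma level_generates:
  assumes "elements_mat U \<subseteq> gauss_rats"
  shows "level U \<in> gauss_Gamma"
    and "elements_mat (level U \<cdot>\<^sub>m U) \<subseteq> gauss_ints"
    and "\<And>m. m \<in> gauss_ints \<Longrightarrow> elements_mat (m \<cdot>\<^sub>m U) \<subseteq> gauss_ints
           \<Longrightarrow> \<exists>q\<in>gauss_ints. m = q * level U"
proof -
  define I where "I = {l \<in> gauss_ints. elements_mat (l \<cdot>\<^sub>m U) \<subseteq> gauss_ints}"
  have I_diff: "a - b \<in> I" if "a \<in> I" "b \<in> I" for a b
    using that by (auto simp: I_def elements_smult_mat left_diff_distrib intro: gauss_ints_diff)
  have I_mult: "c * a \<in> I" if "a \<in> I" "c \<in> gauss_ints" for a c
    using that by (auto simp: I_def elements_smult_mat mult.assoc intro: gauss_ints_mult)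
  define minimal where "minimal l \<longleftrightarrow> l \<in> gauss_Gamma \<and> l \<in> I \<and>
    (\<forall>m\<in>gauss_Gamma. m \<in> I \<longrightarrow> (cmod l)\<^sup>2 \<le> (cmod m)\<^sup>2)" for l
  have Gamma_ints: "z \<in> gauss_Gamma \<Longrightarrow> z \<in> gauss_ints" for z
    by (simp add: gauss_Gamma_def)
  have units: "u \<in> gauss_ints" "cmod u = 1" if "u \<in> {1, -1, \<i>, -\<i>}" for u
    using that by (auto simp: gauss_ints_def)
  have "\<exists>l. minimal l"
  proof -
    obtain d :: nat where "d > 0" "\<forall>z\<in>elements_mat U. of_nat d * z \<in> gauss_ints"
      using gauss_rats_common_denominator[OF finite_elements_mat assms] by blast
    then have d: "of_nat d \<in> gauss_Gamma \<and> of_nat d \<in> I"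
      by (simp add: I_def elements_smult_mat gauss_Gamma_def gauss_ints_of_nat)
    \<comment> \<open>Norms of Gaussian integers are natural numbers, so the floor loses nothing and
      only makes the least-number principle applicable.\<close>
    then obtain l where l: "l \<in> gauss_Gamma \<and> l \<in> I"
      and min: "\<And>m. m \<in> gauss_Gamma \<and> m \<in> I \<Longrightarrow> nat \<lfloor>(cmod l)\<^sup>2\<rfloor> \<le> nat \<lfloor>(cmod m)\<^sup>2\<rfloor>"
      using ex_has_least_nat[of "\<lambda>l. l \<in> gauss_Gamma \<and> l \<in> I" _ "\<lambda>l. nat \<lfloor>(cmod l)\<^sup>2\<rfloor>"]
      by blast
    have "(cmod l)\<^sup>2 \<le> (cmod m)\<^sup>2" if m: "m \<in> gauss_Gamma" "m \<in> I" for m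
    proof -
      obtain j k :: nat where "(cmod l)\<^sup>2 = real j" "(cmod m)\<^sup>2 = real k"
        using gauss_ints_norm_nat Gamma_ints l m(1) by metis
      with min[of m] m show ?thesis by simp
    qed
    then show ?thesis using l by (auto simp: minimal_def)
  qed
  then obtain l where l: "minimal l" by blast
  have l0: "l \<noteq> 0" using l by (auto simp: minimal_def gauss_Gamma_def)
  have gen: "\<exists>q\<in>gauss_ints. m = q * l" if m: "m \<in> I" for m
  proof -
    obtain q where q: "q \<in> gauss_ints" "cmod (m / l - q) < 1"
      by (rule gauss_ints_approx)
    define r where "r = m - q * l"
    have rI: "r \<in> I"
      unfolding r_def using m q(1) l by (intro I_diff I_mult) (auto simp: minimal_def)
    have "r = (m / l - q) * l" using l0 by (simp add: r_def field_simps)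
    then have "cmod r = cmod (m / l - q) * cmod l" by (simp add: norm_mult)
    also have "\<dots> < 1 * cmod l"
      using q(2) l0 by (intro mult_strict_right_mono) auto
    finally have less: "cmod r < cmod l" by simp
    \<comment> \<open>A nonzero remainder would have an associate in \<open>gauss_Gamma\<close>,
      still in \<open>I\<close> and of smaller norm than \<open>l\<close>.\<close>
    have "r = 0"
    proof (rule ccontr)
      assume "r \<noteq> 0"
      then obtain u where u: "u \<in> {1, -1, \<i>, -\<i>}" "u * r \<in> gauss_Gamma"
        using gauss_Gamma_associate[of r] rI unfolding I_def by blast
      then have "(cmod l)\<^sup>2 \<le> (cmod (u * r))\<^sup>2"
        using l I_mult[OF rI units(1)[OF u(1)]] by (auto simp: minimal_def)
      then have "(cmod l)\<^sup>2 \<le> (cmod r)\<^sup>2"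
        using units(2)[OF u(1)] by (simp add: norm_mult)
      then show False
        using less by (meson abs_le_square_iff norm_ge_zero not_le power_strict_mono zero_less_numeral)
    qed
    then show ?thesis using q(1) by (auto simp: r_def)
  qed
  \<comment> \<open>Two minimal elements have equal norm, so the quotient \<open>q\<close> has
    modulus 1 and is a unit; both lying in \<open>gauss_Gamma\<close> leaves only 1.\<close>
  have uniq: "m = l" if m: "minimal m" for m
  proof -
    obtain q where q: "q \<in> gauss_ints" "m = q * l"
      using gen m by (auto simp: minimal_def)
    have "(cmod m)\<^sup>2 = (cmod l)\<^sup>2"
      using l m by (force simp: minimal_def intro: antisym)
    then have "cmod m = cmod l" by (simp add: power2_eq_iff_nonneg)
    then have "cmod q = 1" using q(2) l0 by (simp add: norm_mult)
    then have "q = 1"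
      using gauss_Gamma_unit_multiple[of l q] gauss_ints_norm_1[OF q(1)] l m q(2)
      by (auto simp: minimal_def)
    then show ?thesis using q(2) by simp
  qed
  have "level U = (THE l. minimal l)"
    unfolding level_def minimal_def I_def
    by (rule arg_cong[where f = The]) (auto simp: fun_eq_iff Gamma_ints)
  also have "\<dots> = l"
    using l uniq by (rule the_equality)
  finally have level: "level U = l" .
  show "level U \<in> gauss_Gamma" "elements_mat (level U \<cdot>\<^sub>m U) \<subseteq> gauss_ints"
    using l by (simp_all add: level minimal_def I_def)
  show "\<exists>q\<in>gauss_ints. m = q * level U"
    if "m \<in> gauss_ints" "elements_mat (m \<cdot>\<^sub>m U) \<subseteq> gauss_ints" for m
    using gen[of m] that by (simp add: level I_def)
qed

text \<open>Conjugating \<open>level U * cnj z\<close> shows that \<open>cnj (level U)\<close>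
  clears the denominators as well, hence is a multiple of the generator. Equal moduli make the
  factor a unit.\<close>

lemma level_associate_cnj:
  assumes rat: "elements_mat U \<subseteq> gauss_rats"
    and conj: "\<And>z. z \<in> elements_mat U \<Longrightarrow> cnj z \<in> elements_mat U"
  obtains u where "u \<in> {1, -1, \<i>, -\<i>}" "cnj (level U) = u * level U"
proof -
  let ?l = "level U"
  have l: "?l \<in> gauss_ints" "?l \<noteq> 0"
    using level_generates(1)[OF rat] by (auto simp: gauss_Gamma_def)
  have "cnj ?l * z \<in> gauss_ints" if "z \<in> elements_mat U" for z
  proof -
    have "?l * cnj z \<in> gauss_ints"
      using level_generates(2)[OF rat] conj[OF that] by (simp add: elements_smult_mat)
    then show ?thesis
      by (metis complex_cnj_cnj complex_cnj_mult gauss_ints_cnj)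
  qed
  then obtain q where q: "q \<in> gauss_ints" "cnj ?l = q * ?l"
    using level_generates(3)[OF rat, of "cnj ?l"] l by (auto simp: elements_smult_mat gauss_ints_cnj)
  have "cmod (cnj ?l) = cmod q * cmod ?l" by (simp only: q(2) norm_mult)
  then have "cmod q = 1" using l by simp
  then show ?thesis using gauss_ints_norm_1 q that by blast
qed

subsection \<open>Walk matrices of self-converse graphs\<close>

lemma herm_adj_carrier [simp]: "herm_adj n G \<in> carrier_mat n n"
  by (simp add: herm_adj_def)

lemma walk_matrix_carrier [simp]: "walk_matrix n A \<in> carrier_mat n n"
  by (simp add: walk_matrix_def mat_of_cols_def)

lemma all_one_vec_carrier [simp]: "all_one_vec n \<in> carrier_vec n"
  by (simp add: all_one_vec_def)

lemma walk_matrix_index: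
  assumes "A \<in> carrier_mat n n" "u < n" "k < n"
  shows "walk_matrix n A $$ (u, k) = (\<Sum>v<n. (A ^\<^sub>m k) $$ (u, v))"
proof -
  have "A ^\<^sub>m k \<in> carrier_mat n n"
    using assms(1) by (rule pow_carrier_mat)
  then show ?thesis
    using assms
    by (auto simp: walk_matrix_def mat_of_cols_index all_one_vec_def scalar_prod_def
        lessThan_atLeast0 intro!: sum.cong)
qed

section \<open>Conjugation as a permutation of vertices\<close>

lemma self_converse_herm_adj:
  assumes "G \<in> self_converse_graphs n"
  obtains f where "bij_betw f {..<n} {..<n}"
    and "\<And>u v. u < n \<Longrightarrow> v < n \<Longrightarrow> herm_adj n G $$ (f u, f v) = cnj (herm_adj n G $$ (u, v))"
proof -
  have G: "G \<in> mixed_graphs n"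
    using assms by (simp add: self_converse_graphs_def)
  obtain f where f: "bij_betw f {..<n} {..<n}"
    and iso: "\<And>u v. u < n \<Longrightarrow> v < n \<Longrightarrow>
      ({u, v} \<in> edges G \<longleftrightarrow> {f u, f v} \<in> edges G) \<and> ((u, v) \<in> arcs G \<longleftrightarrow> (f v, f u) \<in> arcs G)"
    using assms by (auto simp: self_converse_graphs_def mixed_graph_iso_def converse_graph_def)
  have "herm_adj n G $$ (f u, f v) = cnj (herm_adj n G $$ (u, v))" if "u < n" "v < n" for u v
  proof -
    have "f u < n" "f v < n"
      using bij_betw_apply[OF f] that by auto
    \<comment> \<open>\<open>herm_adj\<close> tests \<open>(u, v)\<close> before
      \<open>(v, u)\<close>; excluding opposite arcs makes the order of the tests harmless, so
      reversal really swaps \<open>\<i>\<close> and \<open>-\<i>\<close>.\<close>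
    moreover have "\<not> ((u, v) \<in> arcs G \<and> (v, u) \<in> arcs G)"
      using G by (auto simp: mixed_graphs_def)
    ultimately show ?thesis
      using iso[OF that] iso[OF that(2,1)] that by (auto simp: herm_adj_def)
  qed
  with f show ?thesis by (rule that)
qed

text \<open>Simultaneous permutation of rows and columns and entrywise conjugation both respect
  matrix products, so their agreement on \<open>A\<close> passes to powers. In coordinates, the
  summation index is reindexed by \<open>f\<close>.\<close>

lemma pow_mat_conj_symmetry:
  fixes A :: "complex mat"
  assumes A: "A \<in> carrier_mat n n" and f: "bij_betw f {..<n} {..<n}"
    and sym: "\<And>u v. u < n \<Longrightarrow> v < n \<Longrightarrow> A $$ (f u, f v) = cnj (A $$ (u, v))"
    and uv: "u < n" "v < n"
  shows "(A ^\<^sub>m k) $$ (f u, f v) = cnj ((A ^\<^sub>m k) $$ (u, v))"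
  using uv
proof (induction k arbitrary: u v)
  case 0
  have "f u < n" "f v < n" "f u = f v \<longleftrightarrow> u = v"
    using bij_betw_apply[OF f] bij_betw_imp_inj_on[OF f] 0 by (auto simp: inj_on_eq_iff)
  then show ?case using 0 A by auto
next
  case (Suc k)
  have lt: "f w < n" if "w < n" for w
    using bij_betw_apply[OF f] that by auto
  have Ak: "A ^\<^sub>m k \<in> carrier_mat n n"
    using A by (rule pow_carrier_mat)
  have entry: "(A ^\<^sub>m Suc k) $$ (i, j) = (\<Sum>w<n. (A ^\<^sub>m k) $$ (i, w) * A $$ (w, j))"
    if "i < n" "j < n" for i j
    using that A Ak by (auto simp: scalar_prod_def lessThan_atLeast0 intro!: sum.cong)
  have "(A ^\<^sub>m Suc k) $$ (f u, f v) = (\<Sum>w<n. (A ^\<^sub>m k) $$ (f u, w) * A $$ (w, f v))"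
    using Suc.prems by (intro entry lt)
  also have "\<dots> = (\<Sum>w<n. (A ^\<^sub>m k) $$ (f u, f w) * A $$ (f w, f v))"
    by (rule sum.reindex_bij_betw[OF f, symmetric])
  also have "\<dots> = (\<Sum>w<n. cnj ((A ^\<^sub>m k) $$ (u, w) * A $$ (w, v)))"
    using Suc by (intro sum.cong) (auto simp: sym)
  also have "\<dots> = cnj ((A ^\<^sub>m Suc k) $$ (u, v))"
    using Suc.prems by (simp only: entry cnj_sum)
  finally show ?case .
qed

text \<open>Entries of the walk matrix are row sums of powers of \<open>A\<close>. Permuting the
  columns of a power does not change its row sums, so only the row index is moved by
  \<open>f\<close>.\<close>

lemma walk_matrix_conj_symmetry:
  assumes A: "A \<in> carrier_mat n n" and f: "bij_betw f {..<n} {..<n}"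
    and sym: "\<And>u v. u < n \<Longrightarrow> v < n \<Longrightarrow> A $$ (f u, f v) = cnj (A $$ (u, v))"
    and "u < n" "k < n"
  shows "walk_matrix n A $$ (f u, k) = cnj (walk_matrix n A $$ (u, k))"
proof -
  have "f u < n" using bij_betw_apply[OF f] assms(4) by auto
  then have "walk_matrix n A $$ (f u, k) = (\<Sum>v<n. (A ^\<^sub>m k) $$ (f u, v))"
    using A assms(5) by (intro walk_matrix_index)
  also have "\<dots> = (\<Sum>v<n. (A ^\<^sub>m k) $$ (f u, f v))"
    by (rule sum.reindex_bij_betw[OF f, symmetric])
  also have "\<dots> = (\<Sum>v<n. cnj ((A ^\<^sub>m k) $$ (u, v)))"
    using assms by (intro sum.cong refl pow_mat_conj_symmetry[OF A f sym]) auto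
  also have "\<dots> = cnj (walk_matrix n A $$ (u, k))"
    using assms by (simp add: walk_matrix_index)
  finally show ?thesis .
qed

section \<open>Transport of walk matrices along \<open>U\<close>\<close>

lemma pow_mat_intertwine:
  fixes A B U :: "'a :: semiring_1 mat"
  assumes [simp]: "A \<in> carrier_mat n n" "B \<in> carrier_mat n n" "U \<in> carrier_mat n n"
    and AU: "A * U = U * B"
  shows "A ^\<^sub>m k * U = U * B ^\<^sub>m k"
proof (induction k)
  case 0
  have "dim_row A = n" "dim_row B = n"
    using assms by blast+
  then show ?case
    by (simp add: left_mult_one_mat[of _ n n] right_mult_one_mat[of _ n n])
next
  case (Suc k)
  have [simp]: "A ^\<^sub>m k \<in> carrier_mat n n" "B ^\<^sub>m k \<in> carrier_mat n n"
    by (auto intro: pow_carrier_mat)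
  have "A ^\<^sub>m Suc k * U = A ^\<^sub>m k * (A * U)"
    by (simp add: assoc_mult_mat[of _ n n _ n _ n])
  also have "\<dots> = (A ^\<^sub>m k * U) * B"
    by (simp add: AU assoc_mult_mat[of _ n n _ n _ n])
  also have "\<dots> = U * B ^\<^sub>m Suc k"
    by (simp add: Suc assoc_mult_mat[of _ n n _ n _ n])
  finally show ?case .
qed

text \<open>Writing e for the all-one vector, column \<open>k\<close> is
  \<open>A ^\<^sub>m k\<close> applied to e = \<open>U\<close> e, and \<open>U\<close> can be moved
  to the front past the power, turning \<open>A\<close> into \<open>B\<close>.\<close>

lemma walk_matrix_intertwine:
  assumes [simp]: "A \<in> carrier_mat n n" "B \<in> carrier_mat n n" "U \<in> carrier_mat n n"
    and AU: "A * U = U * B" and Ue: "U *\<^sub>v all_one_vec n = all_one_vec n"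
  shows "walk_matrix n A = U * walk_matrix n B"
proof (rule mat_col_eqI)
  fix k assume "k < dim_col (U * walk_matrix n B)"
  then have k: "k < n" by (simp add: walk_matrix_def)
  have [simp]: "A ^\<^sub>m k \<in> carrier_mat n n" "B ^\<^sub>m k \<in> carrier_mat n n"
    by (auto intro: pow_carrier_mat)
  have col: "col (walk_matrix n M) k = M ^\<^sub>m k *\<^sub>v all_one_vec n"
    if "M ^\<^sub>m k \<in> carrier_mat n n" for M
    using k that by (simp add: walk_matrix_def)
  have "col (walk_matrix n A) k = A ^\<^sub>m k *\<^sub>v (U *\<^sub>v all_one_vec n)"
    by (simp add: col Ue)
  also have "\<dots> = (A ^\<^sub>m k * U) *\<^sub>v all_one_vec n"
    by (simp add: assoc_mult_mat_vec[of _ n n _ n])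
  also have "\<dots> = U *\<^sub>v col (walk_matrix n B) k"
    by (simp add: pow_mat_intertwine[OF assms(1-4)] col assoc_mult_mat_vec[of _ n n _ n])
  also have "\<dots> = col (U * walk_matrix n B) k"
    using k by (simp add: col_mult2[of _ n n _ n])
  finally show "col (walk_matrix n A) k = col (U * walk_matrix n B) k" .
qed (use carrier_matD[OF assms(3)] in \<open>auto simp: walk_matrix_def\<close>)

lemma mult_mat_right_cancel_det:
  fixes W :: "'a :: field mat"
  assumes W: "W \<in> carrier_mat n n" "det W \<noteq> 0"
    and V: "V \<in> carrier_mat n n" "U \<in> carrier_mat n n" and eq: "V * W = U * W"
  shows "V = U"
proof -
  \<comment> \<open>The argument \<open>()\<close> only fills the extension slot of the ring record
    \<open>ring_mat\<close>.\<close>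
  obtain X where X: "X \<in> carrier_mat n n" "W * X = 1\<^sub>m n"
    using det_non_zero_imp_unit[OF W, of "()"] by (auto simp: Units_def ring_mat_def)
  have "V = V * W * X"
    using V W X by (simp add: assoc_mult_mat[of _ n n _ n _ n])
  also have "\<dots> = U"
    unfolding eq using V W X by (simp add: assoc_mult_mat[of _ n n _ n _ n])
  finally show ?thesis .
qed

text \<open>Let \<open>V\<close> be the conjugate of \<open>U\<close> with rows permuted by
  \<open>f\<close> and columns by \<open>g\<close>, the permutations belonging to \<open>G\<close>
  and \<open>H\<close>. The symmetries of the two walk matrices make \<open>V\<close> satisfy the
  same equation as \<open>U\<close>, which has only one solution since the walk matrix of
  \<open>H\<close> is invertible.\<close>

lemma unitary_set_conj_symmetry:
  assumes G: "G \<in> self_converse_graphs n"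
    and det: "det (walk_matrix n (herm_adj n G)) \<noteq> 0"
    and U: "U \<in> unitary_set n G"
  obtains f g where "bij_betw f {..<n} {..<n}" "bij_betw g {..<n} {..<n}"
    and "\<And>u v. u < n \<Longrightarrow> v < n \<Longrightarrow> U $$ (u, v) = cnj (U $$ (f u, g v))"
proof -
  let ?A = "herm_adj n G"
  obtain H where H: "H \<in> self_converse_graphs n" "mat_adjoint U * ?A * U = herm_adj n H"
    and Uc [simp]: "U \<in> carrier_mat n n" and UU: "U * mat_adjoint U = 1\<^sub>m n"
    and Ue: "U *\<^sub>v all_one_vec n = all_one_vec n"
    using U by (auto simp: unitary_set_def gauss_rat_unitary_def unitary_mat_def)
  let ?B = "herm_adj n H"
  have [simp]: "mat_adjoint U \<in> carrier_mat n n"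
    using mat_of_rows_carrier(1)[of n "map conjugate (cols U)"] carrier_matD[OF Uc]
    by (simp add: mat_adjoint_def)
  have [simp]: "?A * U \<in> carrier_mat n n"
    by (rule mult_carrier_mat[of _ n n]) simp_all
  \<comment> \<open>Multiplying the similarity by \<open>U\<close> on the left cancels the adjoint
    and yields the intertwining relation.\<close>
  have "U * ?B = U * (mat_adjoint U * (?A * U))"
    unfolding H(2)[symmetric] by (simp add: assoc_mult_mat[of _ n n _ n _ n])
  also have "\<dots> = (U * mat_adjoint U) * (?A * U)"
    by (rule assoc_mult_mat[of _ n n _ n _ n, symmetric]) simp_all
  also have "\<dots> = ?A * U"
    by (simp add: UU left_mult_one_mat[of _ n n])
  finally have AU: "?A * U = U * ?B" by simp
  have walk: "walk_matrix n ?A = U * walk_matrix n ?B"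
    by (rule walk_matrix_intertwine[OF _ _ _ AU Ue]) simp_all
  \<comment> \<open>By multiplicativity, a zero determinant for \<open>H\<close> would force one for
    \<open>G\<close>.\<close>
  then have detB: "det (walk_matrix n ?B) \<noteq> 0"
    using det by (auto simp: det_mult[of _ n])
  obtain f where f: "bij_betw f {..<n} {..<n}"
    and f_sym: "\<And>u v. u < n \<Longrightarrow> v < n \<Longrightarrow> ?A $$ (f u, f v) = cnj (?A $$ (u, v))"
    using self_converse_herm_adj[OF G] by blast
  obtain g where g: "bij_betw g {..<n} {..<n}"
    and g_sym: "\<And>u v. u < n \<Longrightarrow> v < n \<Longrightarrow> ?B $$ (g u, g v) = cnj (?B $$ (u, v))"
    using self_converse_herm_adj[OF H(1)] by blast
  define V where "V = mat n n (\<lambda>(u, v). cnj (U $$ (f u, g v)))"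
  have Vc [simp]: "V \<in> carrier_mat n n" by (simp add: V_def)
  have entry: "(M * walk_matrix n ?B) $$ (u, k) =
      (\<Sum>v<n. M $$ (u, v) * walk_matrix n ?B $$ (v, k))"
    if "M \<in> carrier_mat n n" "u < n" "k < n" for M u k
    using that walk_matrix_carrier[of n ?B]
    by (auto simp: scalar_prod_def lessThan_atLeast0 simp del: walk_matrix_carrier intro!: sum.cong)
  have "V * walk_matrix n ?B = U * walk_matrix n ?B"
  proof (rule eq_matI)
    fix u k assume "u < dim_row (U * walk_matrix n ?B)" "k < dim_col (U * walk_matrix n ?B)"
    then have u: "u < n" and k: "k < n"
      using Uc walk_matrix_carrier[of n ?B] by auto
    have fu: "f u < n" using bij_betw_apply[OF f] u by auto
    have "(V * walk_matrix n ?B) $$ (u, k) =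
        (\<Sum>v<n. cnj (U $$ (f u, g v) * walk_matrix n ?B $$ (g v, k)))"
      using u k by (simp add: entry V_def walk_matrix_conj_symmetry[OF _ g g_sym])
    also have "\<dots> = cnj (\<Sum>v<n. U $$ (f u, g v) * walk_matrix n ?B $$ (g v, k))"
      by (simp only: cnj_sum)
    \<comment> \<open>The symmetry of \<open>H\<close> put \<open>g\<close> into both factors, so it
      disappears on reindexing. What remains is row \<open>f u\<close> of
      \<open>U * walk_matrix n ?B\<close>, a row of the walk matrix of \<open>G\<close>, and the
      symmetry of \<open>G\<close> then undoes \<open>f\<close> together with the
      conjugation.\<close>
    also have "\<dots> = cnj (\<Sum>v<n. U $$ (f u, v) * walk_matrix n ?B $$ (v, k))"
      by (rule arg_cong[where f = cnj], rule sum.reindex_bij_betw[OF g])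
    also have "\<dots> = cnj (walk_matrix n ?A $$ (f u, k))"
      using fu k by (simp only: entry[OF Uc] walk)
    also have "\<dots> = walk_matrix n ?A $$ (u, k)"
      using u k by (simp add: walk_matrix_conj_symmetry[OF _ f f_sym])
    finally show "(V * walk_matrix n ?B) $$ (u, k) = (U * walk_matrix n ?B) $$ (u, k)"
      by (simp only: walk)
  qed (use carrier_matD[OF Uc] in \<open>simp_all add: V_def\<close>)
  then have "V = U"
    by (rule mult_mat_right_cancel_det[OF walk_matrix_carrier detB Vc Uc])
  have "U $$ (u, v) = cnj (U $$ (f u, g v))" if "u < n" "v < n" for u v
  proof -
    have "U $$ (u, v) = V $$ (u, v)" by (simp only: \<open>V = U\<close>)
    also have "\<dots> = cnj (U $$ (f u, g v))" using that by (simp add: V_def)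
    finally show ?thesis .
  qed
  with f g show ?thesis by (rule that)
qed

section \<open>From the symmetry of \<open>U\<close> to the form of its level\<close>

theorem theorem12:
  fixes n :: nat and G :: mixed_graph and U :: "complex mat"
  assumes "G \<in> self_converse_graphs n"
    and "det (walk_matrix n (herm_adj n G)) \<noteq> 0"
    and "U \<in> unitary_set n G"
  shows "gauss_associates (level U) (cnj (level U)) \<and>
    (\<exists>a::nat. a > 0 \<and> (level U = of_nat a \<or> level U = of_nat a * (1 + \<i>)))"
proof -
  have Uc: "U \<in> carrier_mat n n" and rat: "elements_mat U \<subseteq> gauss_rats"
    using assms(3) by (auto simp: unitary_set_def gauss_rat_unitary_def unitary_mat_def)
  obtain f g where fg: "bij_betw f {..<n} {..<n}" "bij_betw g {..<n} {..<n}"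
    and sym: "\<And>u v. u < n \<Longrightarrow> v < n \<Longrightarrow> U $$ (u, v) = cnj (U $$ (f u, g v))"
    using unitary_set_conj_symmetry[OF assms] by blast
  \<comment> \<open>Only the set of entries matters for the level, so the positions moved by
    \<open>f\<close> and \<open>g\<close> can be forgotten.\<close>
  have "cnj z \<in> elements_mat U" if z: "z \<in> elements_mat U" for z
  proof -
    obtain i j where ij: "i < n" "j < n" "z = U $$ (i, j)"
      using elements_matD[OF z] Uc by auto
    have "cnj z = U $$ (f i, g j)"
      using sym[OF ij(1,2)] ij(3) by simp
    moreover have "f i < n" "g j < n"
      using ij bij_betw_apply[OF fg(1)] bij_betw_apply[OF fg(2)] by auto
    ultimately show ?thesis using Uc by blast
  qed
  then obtain u where u: "u \<in> {1, -1, \<i>, -\<i>}" "cnj (level U) = u * level U"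
    using level_associate_cnj[OF rat] by blast
  have l: "level U \<in> gauss_Gamma" by (rule level_generates(1)[OF rat])
  then have "level U \<in> gauss_ints" by (simp add: gauss_Gamma_def)
  \<comment> \<open>Conjugating the relation \<open>cnj (level U) = u * level U\<close> moves the
    unit to the side required by \<open>gauss_associates\<close>.\<close>
  moreover have "level U = cnj u * cnj (level U)" "cnj u \<in> {1, -1, \<i>, -\<i>}"
    using u by auto
  ultimately have "gauss_associates (level U) (cnj (level U))"
    unfolding gauss_associates_def gauss_ints_cnj by blast
  then show ?thesis using gauss_Gamma_associate_cnj[OF l u] by blast
qed

end
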